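(* Let $S:\mathbb{R}^n\times\mathbb{R}^m\to\mathbb{R}$ be convex-concave and continuously differentiable, and suppose that $S$ has at least one saddle point. Suppose moreover that $S$ has an observable certificate $h:\mathbb{R}^n\times\mathbb{R}^m\to\mathbb{R}^2_{\ge 0}$. Then the saddle flow dynamics of $S$, $$\dot x=-\nabla_x S(x,y),\qquad \dot y=+\nabla_y S(x,y),$$ asymptotically converge to some saddle point of $S$; that is, for every trajectory $(x(t),y(t))$, $t\ge 0$, of these dynamics there is a saddle point $(x_\star,y_\star)$ of $S$ with $(x(t),y(t))\to(x_\star,y_\star)$ as $t\to\infty$.
   Context: Inequalities between vectors are entrywise. $\nabla_x S,\nabla_y S$ denote the (column) partial gradients. Convex-concave: $S(\cdot,y)$ is convex for every $y\in\mathbb{R}^m$ and $S(x,\cdot)$ is concave for every $x\in\mathbb{R}^n$. Saddle point of $S$: a point $(x_\star,y_\star)\in\mathbb{R}^n\times\mathbb{R}^m$ such that $S(x_\star,y)\le S(x_\star,y_\star)\le S(x,y_\star)$ for all $x\in\mathbb{R}^n$ and all $y\in\mathbb{R}^m$. Observable certificate: a function $h:\mathbb{R}^n\times\mathbb{R}^m\to\mathbb{R}^2_{\ge 0}$ is an observable certificate of $S$ if and only if (i) there exists a saddle point $(x_\star,y_\star)$ of $S$ such that for all $(x,y)$ $$\begin{bmatrix} S(x_\star,y_\star)-S(x_\star,y)\\ S(x,y_\star)-S(x_\star,y_\star)\end{bmatrix}\ge h(x,y)\ge 0,$$ and (ii) for any trajectory $(x(t),y(t))$ of $\dot x=-\nabla_xS(x,y)$,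 $\dot y=+\nabla_yS(x,y)$ that satisfies $h(x(t),y(t))\equiv 0$, we have $\dot x\equiv 0$ and $\dot y\equiv 0$. *)

theory Defs
  imports "HOL-Analysis.Analysis"
begin

definition gradient :: "('a::real_inner \<Rightarrow> real) \<Rightarrow> 'a \<Rightarrow> 'a" where
  "gradient f z = (THE D. GDERIV f z :> D)"

lemma gradient_eqI:
  assumes "GDERIV f z :> D"
  shows "gradient f z = D"
  unfolding gradient_def
proof (rule the_equality)
  fix D' assume "GDERIV f z :> D'"
  then have "(\<lambda>h. inner h D') = (\<lambda>h. inner h D)"
    using assms unfolding gderiv_def by (rule has_derivative_unique)
  then have "inner (D' - D) (D' - D) = 0"
    by (metis inner_diff_right right_minus_eq)
  then show "D' = D" by simp
qed (rule assms)

definition grad_x :: "(real^'n \<Rightarrow> real^'m \<Rightarrow> real) \<Rightarrow> real^'n \<Rightarrow> real^'m \<Rightarrow> real^'n" where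
  "grad_x S x y = gradient (\<lambda>u. S u y) x"

definition grad_y :: "(real^'n \<Rightarrow> real^'m \<Rightarrow> real) \<Rightarrow> real^'n \<Rightarrow> real^'m \<Rightarrow> real^'m" where
  "grad_y S x y = gradient (\<lambda>v. S x v) y"

(* Joint continuous differentiability, as a function on the product space. *)
definition continuously_differentiable :: "(real^'n \<Rightarrow> real^'m \<Rightarrow> real) \<Rightarrow> bool" where
  "continuously_differentiable S \<longleftrightarrow>
     (\<exists>G. continuous_on UNIV G \<and> (\<forall>z. GDERIV (\<lambda>(x, y). S x y) z :> G z))"

definition convex_concave :: "(real^'n \<Rightarrow> real^'m \<Rightarrow> real) \<Rightarrow> bool" where
  "convex_concave S \<longleftrightarrow>
     (\<forall>y. convex_on UNIV (\<lambda>x. S x y)) \<and> (\<forall>x. concave_on UNIV (\<lambda>y. S x y))"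

definition saddle_point :: "(real^'n \<Rightarrow> real^'m \<Rightarrow> real) \<Rightarrow> real^'n \<Rightarrow> real^'m \<Rightarrow> bool" where
  "saddle_point S xs ys \<longleftrightarrow> (\<forall>x y. S xs y \<le> S xs ys \<and> S xs ys \<le> S x ys)"

(* Classical solutions on [0, \<infinity>); the derivative at t = 0 is one-sided, and the values of
   x and y at negative times are irrelevant. *)
definition saddle_flow_trajectory ::
    "(real^'n \<Rightarrow> real^'m \<Rightarrow> real) \<Rightarrow> (real \<Rightarrow> real^'n) \<Rightarrow> (real \<Rightarrow> real^'m) \<Rightarrow> bool" where
  "saddle_flow_trajectory S x y \<longleftrightarrow>
     (\<forall>t\<ge>0. (x has_vector_derivative - grad_x S (x t) (y t)) (at t within {0..}) \<and>
            (y has_vector_derivative grad_y S (x t) (y t)) (at t within {0..}))"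

(* The order on real^2 is entrywise. That h takes values in the nonnegative quadrant is
   part of the first conjunct. *)
definition observable_certificate ::
    "(real^'n \<Rightarrow> real^'m \<Rightarrow> real) \<Rightarrow> (real^'n \<Rightarrow> real^'m \<Rightarrow> real^2) \<Rightarrow> bool" where
  "observable_certificate S h \<longleftrightarrow>
     (\<exists>xs ys. saddle_point S xs ys \<and>
        (\<forall>x y. vector [S xs ys - S xs y, S x ys - S xs ys] \<ge> h x y \<and> h x y \<ge> 0)) \<and>
     (\<forall>x y. saddle_flow_trajectory S x y \<and> (\<forall>t\<ge>0. h (x t) (y t) = 0) \<longrightarrow>
        (\<forall>t\<ge>0. (x has_vector_derivative 0) (at t within {0..}) \<and>
               (y has_vector_derivative 0) (at t within {0..})))"

end

theory Submission
  imports Defs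
begin

text \<open>
  The operator \<open>F = (\<nabla>\<^sub>x S, - \<nabla>\<^sub>y S)\<close> is monotone, so the distance between any two trajectories
  of \<open>z' = - F z\<close> is nonincreasing. In particular a trajectory \<open>z\<close> is bounded, and if
  \<open>z (t\<^sub>k) \<longlonglongrightarrow> p\<close> then the translates \<open>z (t\<^sub>k + \<cdot>)\<close> are uniformly Cauchy, so they converge to a
  trajectory \<open>w\<close> starting at \<open>p\<close>; no uniqueness or compactness theorem for differential equations is
  needed. Along \<open>w\<close> the distance to the saddle point of the certificate is constant, which forces
  \<open>h = 0\<close> along \<open>w\<close>; hence \<open>w\<close> is at rest and \<open>p\<close> is a saddle point. The distance of \<open>z\<close> to \<open>p\<close> is
  then nonincreasing and tends to \<open>0\<close> along \<open>t\<^sub>k\<close>.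
\<close>

section \<open>Flows of monotone operators\<close>

definition flow_solution :: "('a::real_normed_vector \<Rightarrow> 'a) \<Rightarrow> (real \<Rightarrow> 'a) \<Rightarrow> bool" where
  "flow_solution F z \<longleftrightarrow> (\<forall>t\<ge>0. (z has_vector_derivative - F (z t)) (at t within {0..}))"

definition monotone_operator :: "('a::real_inner \<Rightarrow> 'a) \<Rightarrow> bool" where
  "monotone_operator F \<longleftrightarrow> (\<forall>u v. 0 \<le> inner (F u - F v) (u - v))"

lemma flow_solution_const: "F p = 0 \<Longrightarrow> flow_solution F (\<lambda>t. p)"
  by (simp add: flow_solution_def)

lemma flow_solution_shift:
  assumes "flow_solution F z" "c \<ge> 0"
  shows "flow_solution F (\<lambda>t. z (c + t))"
  unfolding flow_solution_def
proof (intro allI impI)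
  fix t :: real assume t: "0 \<le> t"
  have "(z has_vector_derivative - F (z (c + t))) (at (c + t) within {0..})"
    using assms t by (simp add: flow_solution_def)
  then have "(z has_vector_derivative - F (z (c + t))) (at (c + t) within (\<lambda>t. c + t) ` {0..})"
    by (rule has_vector_derivative_within_subset) (use assms in auto)
  moreover have "((\<lambda>t. c + t) has_vector_derivative 1) (at t within {0..})"
    by (auto intro!: derivative_eq_intros)
  ultimately show "((\<lambda>t. z (c + t)) has_vector_derivative - F (z (c + t))) (at t within {0..})"
    using vector_diff_chain_within[of "\<lambda>t. c + t" 1 t "{0..}" z] by (simp add: o_def)
qed

text \<open>The distance itself may fail to be differentiable where the two curves meet; its square
  is differentiable everywhere, so all monotonicity arguments run on the square.\<close>

lemma has_vector_derivative_dist_square: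
  fixes z w :: "real \<Rightarrow> 'a::real_inner"
  assumes "(z has_vector_derivative z') (at t within A)" "(w has_vector_derivative w') (at t within A)"
  shows "((\<lambda>t. (dist (z t) (w t))\<^sup>2) has_real_derivative 2 * inner (z' - w') (z t - w t))
           (at t within A)"
proof -
  have "((\<lambda>t. z t - w t) has_vector_derivative z' - w') (at t within A)"
    using assms by (rule has_vector_derivative_diff)
  then have d: "((\<lambda>t. z t - w t) has_derivative (\<lambda>s. s *\<^sub>R (z' - w'))) (at t within A)"
    by (simp add: has_vector_derivative_def)
  have "((\<lambda>t. inner (z t - w t) (z t - w t)) has_derivative
      (\<lambda>s. inner (z t - w t) (s *\<^sub>R (z' - w')) + inner (s *\<^sub>R (z' - w')) (z t - w t)))
      (at t within A)"
    using d d by (rule has_derivative_inner)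
  then have "((\<lambda>t. inner (z t - w t) (z t - w t)) has_derivative
      (*) (2 * inner (z' - w') (z t - w t))) (at t within A)"
    by (rule has_derivative_eq_rhs)
      (simp add: fun_eq_iff inner_commute[of "z t - w t"] del: inner_diff_left inner_diff_right)
  then show ?thesis
    by (simp add: has_field_derivative_def dist_norm power2_norm_eq_inner)
qed

text \<open>Serves the uniqueness of derivatives on the half-line, including the one-sided
  derivative at 0.\<close>

lemma at_within_halfline_nontrivial: "t \<ge> 0 \<Longrightarrow> at t within {0::real..} \<noteq> bot"
  using at_le[of "{t<..}" "{0..}" t] trivial_limit_at_right_real[of t]
  by (fastforce simp: bot_unique)

lemma strict_mono_add_le: "strict_mono (r :: nat \<Rightarrow> nat) \<Longrightarrow> r n + k \<le> r (n + k)"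
  by (induction k) (auto simp: Suc_le_eq intro: le_less_trans strict_monoD)

lemma nonincreasing_on_halfline:
  fixes f :: "real \<Rightarrow> real"
  assumes der: "\<And>t. t \<ge> 0 \<Longrightarrow> (f has_real_derivative f' t) (at t within {0..})"
    and "\<And>t. t \<ge> 0 \<Longrightarrow> f' t \<le> 0" "0 \<le> a" "a \<le> b"
  shows "f b \<le> f a"
\<comment> \<open>At 0 only a one-sided derivative is available, so the sign of the derivative is
  used on the open interval and continuity covers the endpoints.\<close>
proof (rule DERIV_nonpos_imp_decreasing_open[OF \<open>a \<le> b\<close>])
  fix t assume "a < t" "t < b"
  then have "at t within {0..} = at t"
    using \<open>0 \<le> a\<close> by (intro at_within_interior) (simp add: interior_Ici)
  then show "\<exists>y. (f has_real_derivative y) (at t) \<and> y \<le> 0"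
    using der[of t] assms \<open>a < t\<close> by force
next
  have "continuous_on {0..} f"
    using der by (meson DERIV_continuous atLeast_iff continuous_on_eq_continuous_within)
  then show "continuous_on {a..b} f"
    by (rule continuous_on_subset) (use \<open>0 \<le> a\<close> in auto)
qed

text \<open>The squared distance has derivative \<open>- 2 * inner (F z - F w) (z - w)\<close>,
  whose sign is given by monotonicity. With \<open>w\<close> constant at a zero of \<open>F\<close>,
  this makes the distance to that zero a Lyapunov function.\<close>

lemma monotone_flow_dist_nonincreasing:
  assumes "monotone_operator F" "flow_solution F z" "flow_solution F w" "0 \<le> a" "a \<le> b"
  shows "dist (z b) (w b) \<le> dist (z a) (w a)"
proof -
  have "(dist (z b) (w b))\<^sup>2 \<le> (dist (z a) (w a))\<^sup>2"
  proof (rule nonincreasing_on_halfline[OF _ _ \<open>0 \<le> a\<close> \<open>a \<le> b\<close>])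
    fix t :: real assume "0 \<le> t"
    then show "((\<lambda>t. (dist (z t) (w t))\<^sup>2) has_real_derivative
        2 * inner (- F (z t) - - F (w t)) (z t - w t)) (at t within {0..})"
      using assms by (intro has_vector_derivative_dist_square) (auto simp: flow_solution_def)
    have "0 \<le> inner (F (z t) - F (w t)) (z t - w t)"
      using assms by (simp add: monotone_operator_def)
    then show "2 * inner (- F (z t) - - F (w t)) (z t - w t) \<le> 0"
      by (simp add: inner_diff_left)
  qed
  then show ?thesis
    by (rule power2_le_imp_le) simp
qed

text \<open>The zero \<open>q\<close> confines all translates to one compact ball, where
  \<open>F\<close> is uniformly continuous. Uniform convergence of the translates therefore passes
  to their derivatives, and the limit may be differentiated.\<close>

lemma monotone_flow_limit_solution:
  fixes F :: "'a::euclidean_space \<Rightarrow> 'a"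
  assumes mono: "monotone_operator F" and cont: "continuous_on UNIV F"
    and z: "flow_solution F z" and q: "F q = 0"
    and r: "\<And>n. r n \<ge> 0" and lim: "(\<lambda>n. z (r n)) \<longlonglongrightarrow> p"
  shows "\<exists>w. flow_solution F w \<and> w 0 = p \<and> (\<forall>s\<ge>0. (\<lambda>n. z (r n + s)) \<longlonglongrightarrow> w s)"
proof -
  \<comment> \<open>At negative \<open>s\<close> the value of \<open>lim\<close> may be arbitrary;
    derivatives within \<open>{0..}\<close> never see it.\<close>
  define w where "w = (\<lambda>s. lim (\<lambda>n. z (r n + s)))"
  define K where "K = cball q (dist (z 0) q)"
  have shift: "flow_solution F (\<lambda>s. z (r n + s))" for n
    using z r by (rule flow_solution_shift)
  have close: "dist (z (r n + s)) (z (r m + s)) \<le> dist (z (r n)) (z (r m))" if "s \<ge> 0" for n m s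
    using monotone_flow_dist_nonincreasing[OF mono shift[of n] shift[of m], of 0 s] that by simp
  have "Cauchy (\<lambda>n. z (r n))"
    using lim by (intro convergent_Cauchy) (auto simp: convergent_def)
  then have "Cauchy (\<lambda>n. z (r n + s))" if "s \<ge> 0" for s
    using close[OF that] unfolding Cauchy_def by (meson le_less_trans)
  then have w: "(\<lambda>n. z (r n + s)) \<longlonglongrightarrow> w s" if "s \<ge> 0" for s
    unfolding w_def using that Cauchy_convergent_iff convergent_LIMSEQ_iff by blast
  have w0: "w 0 = p"
    using w[of 0] lim by (simp add: LIMSEQ_unique)
  \<comment> \<open>Let \<open>m\<close> tend to infinity in \<open>close\<close>. The bound does
    not depend on \<open>s\<close>, so the convergence is uniform on the half-line.\<close>
  have unif: "dist (z (r n + s)) (w s) \<le> dist (z (r n)) p" if "s \<ge> 0" for n s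
  proof (rule LIMSEQ_le)
    show "(\<lambda>m. dist (z (r n + s)) (z (r m + s))) \<longlonglongrightarrow> dist (z (r n + s)) (w s)"
      by (intro tendsto_intros w that)
    show "(\<lambda>m. dist (z (r n)) (z (r m))) \<longlonglongrightarrow> dist (z (r n)) p"
      by (intro tendsto_intros lim)
  qed (use close that in auto)
  have zK: "z t \<in> K" if "t \<ge> 0" for t
    using monotone_flow_dist_nonincreasing[OF mono z flow_solution_const[of F q, OF q], of 0 t] that
    by (simp add: K_def dist_commute)
  have wK: "w s \<in> K" if "s \<ge> 0" for s
  proof (rule closed_sequentially)
    show "closed K" by (simp add: K_def)
    show "(\<lambda>n. z (r n + s)) \<longlonglongrightarrow> w s" using that by (rule w)
    show "z (r n + s) \<in> K" for n using zK r that by simp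
  qed
  have "uniformly_continuous_on K F"
    using cont by (intro compact_uniformly_continuous) (auto simp: K_def intro: continuous_on_subset)
  \<comment> \<open>Uniform convergence of the derivatives, in the form required by
    \<open>has_derivative_sequence\<close>.\<close>
  have *: "\<forall>\<^sub>F n in sequentially. \<forall>s\<in>{0..}. \<forall>h.
      norm (h *\<^sub>R (- F (z (r n + s))) - h *\<^sub>R (- F (w s))) \<le> e * norm h" if "e > 0" for e :: real
  proof -
    obtain d where "d > 0" and d: "\<And>u v. u \<in> K \<Longrightarrow> v \<in> K \<Longrightarrow> dist v u < d \<Longrightarrow> dist (F v) (F u) < e"
      using \<open>uniformly_continuous_on K F\<close> \<open>e > 0\<close> unfolding uniformly_continuous_on_def by metis
    have "\<forall>\<^sub>F n in sequentially. dist (z (r n)) p < d"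
      using lim \<open>d > 0\<close> by (rule tendstoD)
    then show ?thesis
    proof eventually_elim
      case (elim n)
      show ?case
      proof (intro ballI allI)
        fix s h :: real assume "s \<in> {0..}"
        then have "s \<ge> 0" by simp
        then have "dist (F (w s)) (F (z (r n + s))) < e"
          using unif[of s n] elim zK[of "r n + s"] wK[of s] r[of n]
          by (intro d) (auto simp: dist_commute)
        moreover have "h *\<^sub>R (- F (z (r n + s))) - h *\<^sub>R (- F (w s)) = h *\<^sub>R (F (w s) - F (z (r n + s)))"
          by (simp add: algebra_simps)
        ultimately show "norm (h *\<^sub>R (- F (z (r n + s))) - h *\<^sub>R (- F (w s))) \<le> e * norm h"
          by (simp add: dist_norm dist_commute mult.commute[of e] mult_left_mono del: scaleR_minus_right)
      qed
    qed
  qed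
  have "\<exists>g. \<forall>s\<in>{0..}. (\<lambda>n. z (r n + s)) \<longlonglongrightarrow> g s \<and>
      (g has_derivative (\<lambda>h. h *\<^sub>R (- F (w s)))) (at s within {0..})"
  proof (rule has_derivative_sequence[OF _ _ *])
    show "((\<lambda>s. z (r n + s)) has_derivative (\<lambda>h. h *\<^sub>R (- F (z (r n + s))))) (at s within {0..})"
      if "s \<in> {0..}" for n s
      using shift[of n] that by (simp add: flow_solution_def has_vector_derivative_def)
    show "(\<lambda>n. z (r n + 0)) \<longlonglongrightarrow> w 0" by (rule w) simp
  qed auto
  then obtain g where g: "\<And>s. s \<ge> 0 \<Longrightarrow> (\<lambda>n. z (r n + s)) \<longlonglongrightarrow> g s"
      "\<And>s. s \<ge> 0 \<Longrightarrow> (g has_vector_derivative - F (w s)) (at s within {0..})"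
    by (auto simp: has_vector_derivative_def)
  \<comment> \<open>\<open>has_derivative_sequence\<close> yields a limit function of its own; it
    agrees with \<open>w\<close> on the half-line, so \<open>w\<close> inherits its
    derivative.\<close>
  have gw: "g s = w s" if "s \<ge> 0" for s
    using g(1) w that LIMSEQ_unique by blast
  have "flow_solution F w"
    unfolding flow_solution_def
  proof (intro allI impI)
    fix s :: real assume "0 \<le> s"
    then show "(w has_vector_derivative - F (w s)) (at s within {0..})"
      by (intro has_vector_derivative_transform[OF _ _ g(2)]) (auto simp: gw)
  qed
  then show ?thesis using w w0 by blast
qed

text \<open>LaSalle's argument for the Lyapunov function \<open>dist _ q\<close>.\<close>

lemma monotone_flow_limit_points:
  fixes F :: "'a::euclidean_space \<Rightarrow> 'a"
  assumes mono: "monotone_operator F" and cont: "continuous_on UNIV F"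
    and z: "flow_solution F z" and q: "F q = 0"
  obtains r :: "nat \<Rightarrow> nat" and w where "flow_solution F w" "(\<lambda>n. z (real (r n))) \<longlonglongrightarrow> w 0"
    "\<And>s. s \<ge> 0 \<Longrightarrow> inner (F (w s)) (w s - q) = 0"
proof -
  have decr: "dist (z b) q \<le> dist (z a) q" if "0 \<le> a" "a \<le> b" for a b
    using monotone_flow_dist_nonincreasing[OF mono z flow_solution_const[of F q, OF q] that] by simp
  have "z (real n) \<in> cball q (dist (z 0) q)" for n
    using decr[of 0] by (simp add: dist_commute)
  then obtain p r where r: "strict_mono (r :: nat \<Rightarrow> nat)" and p: "(\<lambda>n. z (real (r n))) \<longlonglongrightarrow> p"
    using seq_compactE[OF compact_imp_seq_compact[OF compact_cball[of q "dist (z 0) q"]], of "\<lambda>n. z (real n)"]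
    unfolding o_def by metis
  obtain w where w: "flow_solution F w" "w 0 = p" "\<And>s. s \<ge> 0 \<Longrightarrow> (\<lambda>n. z (real (r n) + s)) \<longlonglongrightarrow> w s"
    using monotone_flow_limit_solution[OF mono cont z q _ p] by auto
  have const: "dist (w s) q = dist (w 0) q" if "s \<ge> 0" for s
  proof (rule antisym)
    show "dist (w s) q \<le> dist (w 0) q"
      using monotone_flow_dist_nonincreasing[OF mono w(1) flow_solution_const[of F q, OF q], of 0 s] that
      by simp
    \<comment> \<open>The sampling time \<open>r (n + k)\<close> with
      \<open>k = nat \<lceil>s\<rceil>\<close> comes no earlier than \<open>r n + s\<close>, so
      \<open>z\<close> is no farther from \<open>q\<close> there. In the limit the later samples
      give \<open>w 0\<close> and the earlier times give \<open>w s\<close>.\<close>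
    show "dist (w 0) q \<le> dist (w s) q"
    proof (rule LIMSEQ_le)
      have "(\<lambda>n. z (real (r n))) \<longlonglongrightarrow> w 0" using p w(2) by simp
      then have "(\<lambda>n. z (real (r (n + nat \<lceil>s\<rceil>)))) \<longlonglongrightarrow> w 0"
        by (rule LIMSEQ_ignore_initial_segment)
      then show "(\<lambda>n. dist (z (real (r (n + nat \<lceil>s\<rceil>)))) q) \<longlonglongrightarrow> dist (w 0) q"
        by (intro tendsto_intros)
      show "(\<lambda>n. dist (z (real (r n) + s)) q) \<longlonglongrightarrow> dist (w s) q"
        by (intro tendsto_intros w that)
      have "real (r n) + s \<le> real (r (n + nat \<lceil>s\<rceil>))" for n
        using strict_mono_add_le[OF r, of n "nat \<lceil>s\<rceil>"] by linarith
      then show "\<exists>N. \<forall>n\<ge>N. dist (z (real (r (n + nat \<lceil>s\<rceil>)))) q \<le> dist (z (real (r n) + s)) q"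
        using that by (intro exI[of _ 0] allI impI decr) auto
    qed
  qed
  \<comment> \<open>Two derivatives of the squared distance are compared: the general formula, and 0
    because the distance is constant.\<close>
  have "inner (F (w s)) (w s - q) = 0" if "s \<ge> 0" for s
  proof -
    have "((\<lambda>t. (dist (w t) q)\<^sup>2) has_real_derivative 2 * inner (- F (w s) - 0) (w s - q))
        (at s within {0..})"
      using w(1) that by (intro has_vector_derivative_dist_square) (auto simp: flow_solution_def)
    moreover have "((\<lambda>t. (dist (w t) q)\<^sup>2) has_real_derivative 0) (at s within {0..})"
    proof (rule has_field_derivative_transform_within[where f="\<lambda>t. (dist (w 0) q)\<^sup>2" and d=1])
      show "(dist (w 0) q)\<^sup>2 = (dist (w t) q)\<^sup>2" if "t \<in> {0..}" for t
        using const[of t] that by simp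
    qed (use that in auto)
    ultimately have "2 * inner (- F (w s) - 0) (w s - q) = 0"
      using at_within_halfline_nontrivial[OF that] by (rule has_field_derivative_unique)
    then show ?thesis by simp
  qed
  then show thesis
    using that r w p by blast
qed

text \<open>The distance to the zero \<open>p\<close> never increases, so one sample within
  \<open>e\<close> of \<open>p\<close> keeps all later times within \<open>e\<close>.\<close>

lemma monotone_flow_tendsto:
  assumes "monotone_operator F" "flow_solution F z" "F p = 0"
    "(\<lambda>n. z (real (r n))) \<longlonglongrightarrow> p"
  shows "(z \<longlongrightarrow> p) at_top"
proof (rule tendstoI)
  fix e :: real assume "e > 0"
  then obtain n where n: "dist (z (real (r n))) p < e"
    using tendstoD[OF assms(4), of e] by (auto simp: eventually_sequentially)
  show "\<forall>\<^sub>F t in at_top. dist (z t) p < e"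
    using eventually_ge_at_top[of "real (r n)"]
  proof eventually_elim
    case (elim t)
    then have "dist (z t) p \<le> dist (z (real (r n))) p"
      using monotone_flow_dist_nonincreasing[OF assms(1,2) flow_solution_const[of F p, OF assms(3)]]
      by simp
    then show ?case using n by simp
  qed
qed

section \<open>Convex-concave functions\<close>

text \<open>Restriction to the line through \<open>x\<close> and \<open>y\<close> reduces this to
  the one-dimensional tangent inequality between 0 and 1.\<close>

lemma convex_on_above_tangent_gderiv:
  fixes f :: "'a::real_inner \<Rightarrow> real"
  assumes conv: "convex_on UNIV f" and D: "GDERIV f x :> D"
  shows "f x + inner D (y - x) \<le> f y"
proof -
  define \<phi> where "\<phi> = (\<lambda>t::real. f (x + t *\<^sub>R (y - x)))"
  have "convex_on UNIV \<phi>"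
  proof (rule convex_onI)
    fix t a b :: real assume "0 < t" "t < 1"
    have "x + ((1 - t) *\<^sub>R a + t *\<^sub>R b) *\<^sub>R (y - x) =
        (1 - t) *\<^sub>R (x + a *\<^sub>R (y - x)) + t *\<^sub>R (x + b *\<^sub>R (y - x))"
      by (simp add: algebra_simps)
    then show "\<phi> ((1 - t) *\<^sub>R a + t *\<^sub>R b) \<le> (1 - t) * \<phi> a + t * \<phi> b"
      unfolding \<phi>_def using convex_onD[OF conv, of t] \<open>0 < t\<close> \<open>t < 1\<close> by simp
  qed simp
  moreover have "(\<phi> has_real_derivative inner D (y - x)) (at 0 within UNIV)"
  proof -
    have 1: "((\<lambda>t::real. x + t *\<^sub>R (y - x)) has_derivative (\<lambda>t. t *\<^sub>R (y - x))) (at 0)"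
      by (auto intro!: derivative_eq_intros)
    have 2: "(f has_derivative (\<lambda>h. inner h D)) (at (x + 0 *\<^sub>R (y - x)))"
      using D by (simp add: gderiv_def)
    have "(\<phi> has_derivative (\<lambda>t. inner (t *\<^sub>R (y - x)) D)) (at 0)"
      unfolding \<phi>_def using has_derivative_compose[OF 1 2] .
    then show ?thesis
      unfolding has_field_derivative_def
      by (rule has_derivative_eq_rhs) (simp add: inner_commute mult.commute fun_eq_iff)
  qed
  ultimately have "\<phi> 1 - \<phi> 0 \<ge> inner D (y - x) * (1 - 0)"
    by (intro convex_on_imp_above_tangent) auto
  then show ?thesis by (simp add: \<phi>_def)
qed

lemma gderiv_eq_0_at_min:
  assumes "GDERIV f x :> D" "\<And>u. f x \<le> f u"
  shows "D = 0"
proof -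
  have "(\<lambda>h. inner h D) = (\<lambda>v. 0)"
    using assms differential_zero_maxmin[of x UNIV f "\<lambda>h. inner h D"] by (auto simp: gderiv_def)
  then have "inner D D = 0" by metis
  then show ?thesis by simp
qed

lemma gderiv_Pair_section:
  fixes f :: "'a::real_inner \<times> 'b::real_inner \<Rightarrow> real"
  assumes "GDERIV f (x, y) :> G"
  shows "GDERIV (\<lambda>u. f (u, y)) x :> fst G" "GDERIV (\<lambda>v. f (x, v)) y :> snd G"
proof -
  have f: "(f has_derivative (\<lambda>h. inner h G)) (at (x, y))"
    using assms by (simp add: gderiv_def)
  have 1: "((\<lambda>u. (u, y)) has_derivative (\<lambda>h. (h, 0))) (at x)"
    and 2: "((\<lambda>v. (x, v)) has_derivative (\<lambda>h. (0, h))) (at y)"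
    by (auto intro!: derivative_eq_intros)
  show "GDERIV (\<lambda>u. f (u, y)) x :> fst G" "GDERIV (\<lambda>v. f (x, v)) y :> snd G"
    using has_derivative_compose[OF 1 f] has_derivative_compose[OF 2 f]
    by (simp_all add: gderiv_def inner_prod_def)
qed

section \<open>The saddle operator: continuity, zeros and monotonicity\<close>

definition saddle_operator :: "(real^'n \<Rightarrow> real^'m \<Rightarrow> real) \<Rightarrow> (real^'n) \<times> (real^'m) \<Rightarrow> (real^'n) \<times> (real^'m)" where
  "saddle_operator S z = (grad_x S (fst z) (snd z), - grad_y S (fst z) (snd z))"

lemma saddle_flow_trajectory_iff:
  "saddle_flow_trajectory S x y \<longleftrightarrow> flow_solution (saddle_operator S) (\<lambda>t. (x t, y t))"
proof -
  have "((\<lambda>t. (x t, y t)) has_vector_derivative (a, b)) (at t within A) \<longleftrightarrow>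
      (x has_vector_derivative a) (at t within A) \<and> (y has_vector_derivative b) (at t within A)" for a b t A
    using bounded_linear.has_vector_derivative[OF bounded_linear_fst, of "\<lambda>t. (x t, y t)" "(a, b)" "at t within A"]
      bounded_linear.has_vector_derivative[OF bounded_linear_snd, of "\<lambda>t. (x t, y t)" "(a, b)" "at t within A"]
    using has_vector_derivative_Pair[of x a _ _ y b] by auto
  then show ?thesis
    by (simp add: saddle_flow_trajectory_def flow_solution_def saddle_operator_def)
qed

context
  fixes S :: "real^'n \<Rightarrow> real^'m \<Rightarrow> real"
  assumes C1: "continuously_differentiable S"
begin

lemma gderiv_grad_x: "GDERIV (\<lambda>u. S u y) x :> grad_x S x y"
  and gderiv_grad_y: "GDERIV (\<lambda>v. S x v) y :> grad_y S x y"
proof -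
  obtain G where G: "GDERIV (\<lambda>(x, y). S x y) (x, y) :> G"
    using C1 unfolding continuously_differentiable_def by blast
  show "GDERIV (\<lambda>u. S u y) x :> grad_x S x y" "GDERIV (\<lambda>v. S x v) y :> grad_y S x y"
    using gderiv_Pair_section[OF G] by (simp_all add: grad_x_def grad_y_def gradient_eqI)
qed

lemma continuous_saddle_operator: "continuous_on UNIV (saddle_operator S)"
proof -
  obtain G where G: "continuous_on UNIV G" "\<And>z. GDERIV (\<lambda>(x, y). S x y) z :> G z"
    using C1 unfolding continuously_differentiable_def by blast
  \<comment> \<open>The partial gradients are the components of the joint gradient, which is
    continuous by assumption.\<close>
  have "saddle_operator S z = (fst (G z), - snd (G z))" for z
    using gderiv_Pair_section[of "\<lambda>(x, y). S x y" "fst z" "snd z" "G z"] G(2)[of z]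
    by (simp add: saddle_operator_def grad_x_def grad_y_def gradient_eqI)
  moreover have "continuous_on UNIV (\<lambda>z. (fst (G z), - snd (G z)))"
    by (intro continuous_intros G(1))
  ultimately show ?thesis
    by (simp cong: continuous_on_cong)
qed

lemma saddle_point_imp_zero: "saddle_point S xs ys \<Longrightarrow> saddle_operator S (xs, ys) = 0"
proof -
  assume sp: "saddle_point S xs ys"
  have "grad_x S xs ys = 0"
    using gderiv_grad_x by (rule gderiv_eq_0_at_min) (use sp in \<open>simp add: saddle_point_def\<close>)
  moreover have "- grad_y S xs ys = 0"
    using GDERIV_minus[OF gderiv_grad_y] by (rule gderiv_eq_0_at_min) (use sp in \<open>simp add: saddle_point_def\<close>)
  ultimately show ?thesis by (simp add: saddle_operator_def zero_prod_def)
qed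

context
  assumes cc: "convex_concave S"
begin

lemma convex_tangent_x: "S x y + inner (grad_x S x y) (u - x) \<le> S u y"
  using cc gderiv_grad_x by (intro convex_on_above_tangent_gderiv) (auto simp: convex_concave_def)

lemma concave_tangent_y: "S x v \<le> S x y + inner (grad_y S x y) (v - y)"
proof -
  have "- S x y + inner (- grad_y S x y) (v - y) \<le> - S x v"
    using cc GDERIV_minus[OF gderiv_grad_y]
    by (intro convex_on_above_tangent_gderiv) (auto simp: convex_concave_def concave_on_def)
  then show ?thesis by simp
qed

lemma monotone_saddle_operator: "monotone_operator (saddle_operator S)"
  unfolding monotone_operator_def
proof (intro allI)
  fix z z' :: "(real^'n) \<times> (real^'m)"
  obtain a b c d where z: "z = (a, b)" "z' = (c, d)" by (metis surj_pair)
  \<comment> \<open>Add the four tangent inequalities linking the corners \<open>(a, b)\<close>,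
    \<open>(c, b)\<close>, \<open>(c, d)\<close>, \<open>(a, d)\<close>: every value of
    \<open>S\<close> cancels and only the inner products remain.\<close>
  show "0 \<le> inner (saddle_operator S z - saddle_operator S z') (z - z')"
    using convex_tangent_x[of a b c] convex_tangent_x[of c d a]
      concave_tangent_y[of a d b] concave_tangent_y[of c b d]
    by (simp add: z saddle_operator_def inner_prod_def inner_diff)
qed

lemma zero_imp_saddle_point:
  assumes "saddle_operator S (xs, ys) = 0"
  shows "saddle_point S xs ys"
  using assms convex_tangent_x[of xs ys] concave_tangent_y[of xs _ ys]
  by (simp add: saddle_point_def saddle_operator_def zero_prod_def)

text \<open>Both tangent inequalities are taken at \<open>(x, y)\<close>, and \<open>S x y\<close>
  cancels. Where the inner product vanishes, the gap on the left is at most 0.\<close>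

lemma saddle_operator_inner_ge:
  "S x ys - S xs y \<le> inner (saddle_operator S (x, y)) ((x, y) - (xs, ys))"
  using convex_tangent_x[of x y xs] concave_tangent_y[of x ys y]
  by (simp add: saddle_operator_def inner_prod_def inner_diff)

end

end

section \<open>From the certificate to convergence\<close>

lemma certificate_bound_eq_0:
  fixes v :: "real^2"
  assumes "vector [a, b] \<ge> v" "v \<ge> 0" "a + b \<le> 0"
  shows "v = 0"
proof -
  have "v $ 1 \<le> a" "v $ 2 \<le> b" "0 \<le> v $ 1" "0 \<le> v $ 2"
    using assms(1,2) by (auto simp: less_eq_vec_def forall_2)
  then show ?thesis using assms(3) by (simp add: vec_eq_iff forall_2)
qed

theorem theorem1:
  fixes S :: "real^'n \<Rightarrow> real^'m \<Rightarrow> real"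
    and h :: "real^'n \<Rightarrow> real^'m \<Rightarrow> real^2"
  assumes "convex_concave S"
    and "continuously_differentiable S"
    and "\<exists>xs ys. saddle_point S xs ys"
    and "observable_certificate S h"
  shows "\<forall>x y. saddle_flow_trajectory S x y \<longrightarrow>
           (\<exists>xs ys. saddle_point S xs ys \<and> ((\<lambda>t. (x t, y t)) \<longlongrightarrow> (xs, ys)) at_top)"
proof (intro allI impI)
  fix x y assume "saddle_flow_trajectory S x y"
  define F where "F = saddle_operator S"
  have z: "flow_solution F (\<lambda>t. (x t, y t))"
    using \<open>saddle_flow_trajectory S x y\<close> by (simp add: saddle_flow_trajectory_iff F_def)
  have mono: "monotone_operator F" and cont: "continuous_on UNIV F"
    using assms by (simp_all add: F_def monotone_saddle_operator continuous_saddle_operator)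
  obtain xs ys where sp: "saddle_point S xs ys"
    and h: "\<And>x y. vector [S xs ys - S xs y, S x ys - S xs ys] \<ge> h x y" "\<And>x y. h x y \<ge> 0"
    and rest: "\<And>x y. saddle_flow_trajectory S x y \<Longrightarrow> \<forall>t\<ge>0. h (x t) (y t) = 0 \<Longrightarrow>
        \<forall>t\<ge>0. (x has_vector_derivative 0) (at t within {0..}) \<and>
               (y has_vector_derivative 0) (at t within {0..})"
    using assms(4) unfolding observable_certificate_def by blast
  have "F (xs, ys) = 0"
    using assms(2) sp unfolding F_def by (rule saddle_point_imp_zero)
  with mono cont z obtain r w where w: "flow_solution F w"
    and r: "(\<lambda>n. (x (real (r n)), y (real (r n)))) \<longlonglongrightarrow> w 0"
    and w_orth: "\<And>s. s \<ge> 0 \<Longrightarrow> inner (F (w s)) (w s - (xs, ys)) = 0"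
    by (rule monotone_flow_limit_points) blast
  have traj: "saddle_flow_trajectory S (\<lambda>t. fst (w t)) (\<lambda>t. snd (w t))"
    using w by (simp add: saddle_flow_trajectory_iff F_def)
  moreover have "\<forall>t\<ge>0. h (fst (w t)) (snd (w t)) = 0"
  proof (intro allI impI)
    fix t :: real assume "0 \<le> t"
    \<comment> \<open>This gap is the sum of the two upper bounds in the certificate, as
      \<open>S xs ys\<close> cancels. Each bound dominates a nonnegative entry of \<open>h\<close>,
      so a nonpositive sum forces \<open>h\<close> to vanish.\<close>
    then have "S (fst (w t)) ys - S xs (snd (w t)) \<le> 0"
      using saddle_operator_inner_ge[OF assms(2,1), of "fst (w t)" ys xs "snd (w t)"] w_orth[of t]
      by (simp add: F_def)
    then show "h (fst (w t)) (snd (w t)) = 0"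
      using h by (intro certificate_bound_eq_0) auto
  qed
  ultimately have "((\<lambda>t. fst (w t)) has_vector_derivative 0) (at 0 within {0..})"
      "((\<lambda>t. snd (w t)) has_vector_derivative 0) (at 0 within {0..})"
    using rest by auto
  then have "((\<lambda>t. (fst (w t), snd (w t))) has_vector_derivative 0) (at 0 within {0..})"
    unfolding zero_prod_def by (rule has_vector_derivative_Pair)
  then have "(w has_vector_derivative 0) (at 0 within {0..})" by simp
  moreover have "(w has_vector_derivative - F (w 0)) (at 0 within {0..})"
    using w by (simp add: flow_solution_def)
  \<comment> \<open>At time 0 the derivative of \<open>w\<close> is both 0 and
    \<open>- F (w 0)\<close>, so the limit point \<open>w 0\<close> is an equilibrium.\<close>
  ultimately have p: "F (w 0) = 0"
    using vector_derivative_unique_within[OF at_within_halfline_nontrivial[OF order_refl]] by fastforce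
  have "saddle_point S (fst (w 0)) (snd (w 0))"
    using p by (intro zero_imp_saddle_point[OF assms(2,1)]) (simp add: F_def)
  moreover have "((\<lambda>t. (x t, y t)) \<longlongrightarrow> (fst (w 0), snd (w 0))) at_top"
    using monotone_flow_tendsto[OF mono z p r] by simp
  ultimately show "\<exists>xs ys. saddle_point S xs ys \<and> ((\<lambda>t. (x t, y t)) \<longlongrightarrow> (xs, ys)) at_top"
    by blast
qed

end
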